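(* Let $w$ be a word in the letters $1,\dots,k$ in which each letter occurs exactly $n$ times. Then \[ \mathrm{charge}(w)=\sum_{j=1}^{k-1}\mathrm{depth}_j(w)\,(k-j). \]
   Context: For $1\le j\le k-1$, $\mathrm{depth}_j(w)$ is defined as follows: take the subword of $w$ consisting of the letters $j$ and $j+1$, and repeatedly delete adjacent pairs consisting of a $j+1$ immediately followed by a $j$; the result has the form $j^r(j+1)^s$, and $\mathrm{depth}_j(w)=s$. For a permutation $\pi$ of $[r]$ (one-line notation), $\mathrm{charge}(\pi)=\mathrm{maj}(\mathrm{rev}(\pi^{-1}))$, where maj is the sum of descent positions and rev is reversal. A word with partition content $(v_1,v_2,\dots)$ is split into $v_1$ standard subwords: take the rightmost $1$, then move left to the first $2$, then left to the first $3$, etc., wrapping around to the right end of the word if the needed letter does not occur to the left, as long as possible; these letters (in original order) form the first subword; repeat on the unused letters. $\mathrm{charge}(w)$ is the sum of the charges of its standard subwords. *)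

theory Defs
  imports Main
begin

text \<open>Words are lists of positive naturals; list indices start at 0, letters and positions in
  one-line notation start at 1.\<close>

inductive del_step :: "nat \<Rightarrow> nat list \<Rightarrow> nat list \<Rightarrow> bool" for j :: nat where
  "del_step j (u @ [Suc j, j] @ v) (u @ v)"

definition depth :: "nat \<Rightarrow> nat list \<Rightarrow> nat" where
  "depth j w = (THE s. \<exists>r. (del_step j)\<^sup>*\<^sup>* (filter (\<lambda>x. x = j \<or> x = Suc j) w)
                              (replicate r j @ replicate s (Suc j)))"

definition maj :: "nat list \<Rightarrow> nat" where
  "maj xs = \<Sum>{i. 1 \<le> i \<and> i < length xs \<and> xs ! (i - 1) > xs ! i}"

definition perm_inverse :: "nat list \<Rightarrow> nat list" where
  "perm_inverse p = map (\<lambda>i. Suc (THE q. q < length p \<and> p ! q = i)) [1..<Suc (length p)]"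

definition perm_charge :: "nat list \<Rightarrow> nat" where
  "perm_charge p = maj (rev (perm_inverse p))"

definition occurrences :: "nat \<Rightarrow> nat list \<Rightarrow> nat set" where
  "occurrences a w = {q. q < length w \<and> w ! q = a}"

text \<open>\<open>chain_pos w i\<close> is the index of the letter \<open>i + 1\<close> selected for the first standard subword
  of \<open>w\<close>, or \<open>None\<close> if the selection stops before that letter. The final \<open>else\<close>
  branch is the wrap-around.\<close>

primrec chain_pos :: "nat list \<Rightarrow> nat \<Rightarrow> nat option" where
  "chain_pos w 0 =
     (if occurrences 1 w = {} then None else Some (Max (occurrences 1 w)))"
| "chain_pos w (Suc i) =
     (case chain_pos w i of
        None \<Rightarrow> None
      | Some p \<Rightarrow>
          (let Q = occurrences (i + 2) w; L = {q \<in> Q. q < p} in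
             if Q = {} then None
             else if L \<noteq> {} then Some (Max L)
             else Some (Max Q)))"

definition chain_set :: "nat list \<Rightarrow> nat set" where
  "chain_set w = {q. \<exists>i. chain_pos w i = Some q}"

primrec extract_subwords :: "nat \<Rightarrow> nat list \<Rightarrow> nat list list" where
  "extract_subwords 0 w = []"
| "extract_subwords (Suc m) w =
     nths w (chain_set w) # extract_subwords m (nths w (- chain_set w))"

definition standard_subwords :: "nat list \<Rightarrow> nat list list" where
  "standard_subwords w = extract_subwords (count_list w 1) w"

text \<open>Meaningful for words of partition content only: then every standard subword is a
  permutation of an initial segment \<open>{1..r}\<close>.\<close>

definition charge :: "nat list \<Rightarrow> nat" where
  "charge w = (\<Sum>u\<leftarrow>standard_subwords w. perm_charge u)"

end

theory Submission
  imports Defs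
begin

text \<open>A permutation \<open>p\<close> of \<open>{1..k}\<close> has charge equal to the sum of \<open>k - j\<close> over the \<open>j\<close> for which
  \<open>j + 1\<close> stands to the right of \<open>j\<close>. In a standard subword this says that the selection wrapped
  around on its way from \<open>j\<close> to \<open>j + 1\<close>, so it suffices that \<open>depth j w\<close> counts these wraps. Give
  the letters \<open>j\<close> and \<open>j + 1\<close> the weights 1 and -1. Since the two letters occur equally often,
  \<open>depth j w\<close> is the largest weight of a prefix of \<open>w\<close>, and removing one standard subword lowers
  this maximum by 1 if the selection wrapped around and leaves it unchanged otherwise.\<close>

section \<open>Maximal prefix sums\<close>

text \<open>Largest sum over all prefixes, the empty one included. The \<open>0\<close> under the
  maximum is the empty prefix, and every other prefix starts with \<open>x\<close>.\<close>

primrec max_prefix_sum :: "int list \<Rightarrow> int" where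
  "max_prefix_sum [] = 0"
| "max_prefix_sum (x # xs) = max 0 (x + max_prefix_sum xs)"

lemma max_prefix_sum_nonneg: "0 \<le> max_prefix_sum xs"
  by (cases xs) auto

lemma sum_list_take_le_max_prefix_sum: "sum_list (take t xs) \<le> max_prefix_sum xs"
proof (induction xs arbitrary: t)
  case (Cons x xs)
  show ?case
  proof (cases t)
    case (Suc s)
    then show ?thesis using Cons.IH[of s] by simp
  qed simp
qed simp

lemma max_prefix_sum_attained: "\<exists>t. max_prefix_sum xs = sum_list (take t xs)"
proof (induction xs)
  case (Cons x xs)
  then obtain t where t: "max_prefix_sum xs = sum_list (take t xs)" by blast
  show ?case
  proof (cases "x + max_prefix_sum xs \<le> 0")
    case True
    then show ?thesis by (intro exI[of _ 0]) simp
  next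
    case False
    then show ?thesis using t by (intro exI[of _ "Suc t"]) simp
  qed
qed simp

text \<open>A zero entry only repeats a prefix sum. Letters can thus be zeroed instead of deleted,
  which keeps all indices fixed.\<close>

lemma max_prefix_sum_filter:
  "max_prefix_sum (map f (filter P xs)) = max_prefix_sum (map (\<lambda>x. if P x then f x else 0) xs)"
  by (induction xs) (auto simp: max_prefix_sum_nonneg max_absorb2)

lemma sum_list_take_update_0:
  fixes xs :: "int list"
  assumes "p < length xs"
  shows "sum_list (take t (xs[p := 0])) = sum_list (take t xs) - (if p < t then xs ! p else 0)"
  using assms
proof (induction xs arbitrary: p t)
  case (Cons x xs)
  then show ?case by (cases p; cases t) auto
qed simp

lemma sum_list_take_mono:
  fixes xs :: "int list"
  assumes "s \<le> t" and "\<And>i. s \<le> i \<Longrightarrow> i < t \<Longrightarrow> i < length xs \<Longrightarrow> 0 \<le> xs ! i"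
  shows "sum_list (take s xs) \<le> sum_list (take t xs)"
  using assms
proof (induction t rule: dec_induct)
  case (step t)
  then have "sum_list (take s xs) \<le> sum_list (take t xs)" by simp
  also have "\<dots> \<le> sum_list (take (Suc t) xs)"
    using step by (cases "t < length xs") (auto simp: take_Suc_conv_app_nth)
  finally show ?case .
qed simp

text \<open>Only prefixes that contain \<open>q\<close> but not \<open>p\<close> change, and they
  gain 1. No entry between \<open>q\<close> and \<open>p\<close> is negative, so before the removal
  their sums are at most the one just before \<open>p\<close>, and the entry at \<open>p\<close>
  raises that one by 1. The old maximum is therefore not exceeded.\<close>

lemma max_prefix_sum_remove_matched:
  assumes "q < p" "p < length xs" "xs ! p = 1" "xs ! q = -1"
    and between: "\<And>i. q < i \<Longrightarrow> i < p \<Longrightarrow> 0 \<le> xs ! i"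
  shows "max_prefix_sum (xs[p := 0, q := 0]) = max_prefix_sum xs"
proof -
  let ?ys = "xs[p := 0, q := 0]"
  have S: "sum_list (take t ?ys) = sum_list (take t xs) + (if q < t \<and> t \<le> p then 1 else 0)" for t
    using assms by (auto simp: sum_list_take_update_0)
  have peak: "sum_list (take p xs) + 1 \<le> max_prefix_sum xs"
    using sum_list_take_le_max_prefix_sum[of "Suc p" xs] assms
    by (simp add: take_Suc_conv_app_nth)
  have "sum_list (take t ?ys) \<le> max_prefix_sum xs" for t
  proof (cases "q < t \<and> t \<le> p")
    case True
    then have "sum_list (take t xs) \<le> sum_list (take p xs)"
      using between by (intro sum_list_take_mono) auto
    then show ?thesis using S peak True by simp
  next
    case False
    then have "sum_list (take t ?ys) = sum_list (take t xs)" using S by simp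
    then show ?thesis using sum_list_take_le_max_prefix_sum[of t xs] by linarith
  qed
  moreover have "sum_list (take t xs) \<le> max_prefix_sum ?ys" for t
    using S[of t] sum_list_take_le_max_prefix_sum[of t ?ys] by (auto split: if_splits)
  ultimately show ?thesis
    using max_prefix_sum_attained[of xs] max_prefix_sum_attained[of ?ys] by (metis order_antisym)
qed

text \<open>Prefixes that contain \<open>p\<close> but not \<open>q\<close> lose 1. All others were
  already below the maximum: a prefix ending by \<open>p\<close> is dominated by the one just before
  \<open>p\<close>, and a prefix reaching past \<open>q\<close> by the total, which is 0, the sum of
  the empty prefix.\<close>

lemma max_prefix_sum_remove_wrapped:
  assumes "p < q" "q < length xs" "xs ! p = 1" "xs ! q = -1" "sum_list xs = 0"
    and before: "\<And>i. i < p \<Longrightarrow> 0 \<le> xs ! i"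
    and after: "\<And>i. q < i \<Longrightarrow> i < length xs \<Longrightarrow> 0 \<le> xs ! i"
  shows "max_prefix_sum (xs[p := 0, q := 0]) = max_prefix_sum xs - 1"
proof -
  let ?ys = "xs[p := 0, q := 0]"
  have S: "sum_list (take t ?ys) = sum_list (take t xs) - (if p < t \<and> t \<le> q then 1 else 0)" for t
    using assms by (auto simp: sum_list_take_update_0)
  have peak: "sum_list (take p xs) + 1 \<le> max_prefix_sum xs"
    using sum_list_take_le_max_prefix_sum[of "Suc p" xs] assms
    by (simp add: take_Suc_conv_app_nth)
  have outside: "sum_list (take t xs) \<le> max_prefix_sum xs - 1" if "\<not> (p < t \<and> t \<le> q)" for t
  proof (cases "t \<le> p")
    case True
    then have "sum_list (take t xs) \<le> sum_list (take p xs)"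
      using before by (intro sum_list_take_mono) auto
    then show ?thesis using peak by simp
  next
    case False
    \<comment> \<open>The right side is the total sum 0; the \<open>max\<close> covers
      \<open>t\<close> beyond the end of the list.\<close>
    then have "sum_list (take t xs) \<le> sum_list (take (max t (length xs)) xs)"
      using after that by (intro sum_list_take_mono) auto
    moreover have "sum_list (take 0 xs) \<le> sum_list (take p xs)"
      using before by (intro sum_list_take_mono) auto
    ultimately show ?thesis using peak assms by simp
  qed
  have "sum_list (take t ?ys) \<le> max_prefix_sum xs - 1" for t
    using S[of t] outside[of t] sum_list_take_le_max_prefix_sum[of t xs] by (auto split: if_splits)
  moreover obtain t where t: "max_prefix_sum xs = sum_list (take t xs)"
    using max_prefix_sum_attained by blast
  \<comment> \<open>By \<open>outside\<close>, a maximal prefix must contain \<open>p\<close> but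
    not \<open>q\<close>, so it is one of those that lose 1.\<close>
  moreover have "sum_list (take t ?ys) = max_prefix_sum xs - 1"
    using S[of t] outside[of t] t by (auto split: if_splits)
  ultimately show ?thesis
    using max_prefix_sum_attained[of ?ys] sum_list_take_le_max_prefix_sum[of t ?ys]
    by (metis order_antisym)
qed

section \<open>Depth\<close>

definition weight :: "nat \<Rightarrow> nat \<Rightarrow> int" where
  "weight j x = (if x = j then 1 else if x = Suc j then -1 else 0)"

lemma sum_list_map_weight:
  "sum_list (map (weight j) w) = int (count_list w j) - int (count_list w (Suc j))"
  by (induction w) (auto simp: weight_def)

lemma del_step_Cons: "del_step j u v \<Longrightarrow> del_step j (x # u) (x # v)"
  by (metis append_Cons del_step.simps)

lemma del_steps_Cons: "(del_step j)\<^sup>*\<^sup>* u v \<Longrightarrow> (del_step j)\<^sup>*\<^sup>* (x # u) (x # v)"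
  by (induction rule: rtranclp_induct) (auto intro: del_step_Cons rtranclp.rtrancl_into_rtrancl)

text \<open>Normalise the tail first. A letter \<open>Suc j\<close> put in front cancels with the
  first \<open>j\<close> if there is one; otherwise the result is already in normal form.\<close>

lemma del_steps_normal_form:
  assumes "set w \<subseteq> {j, Suc j}"
  shows "\<exists>r s. (del_step j)\<^sup>*\<^sup>* w (replicate r j @ replicate s (Suc j))"
  using assms
proof (induction w)
  case Nil
  show ?case by (intro exI[of _ 0]) simp
next
  case (Cons x w)
  then obtain r s where "(del_step j)\<^sup>*\<^sup>* w (replicate r j @ replicate s (Suc j))" by auto
  then have *: "(del_step j)\<^sup>*\<^sup>* (x # w) (x # replicate r j @ replicate s (Suc j))"
    by (rule del_steps_Cons)
  consider "x = j" | "x = Suc j" "r = 0" | r' where "x = Suc j" "r = Suc r'"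
    using Cons.prems by (cases r) auto
  then show ?case
  proof cases
    case 1
    then show ?thesis using * by (intro exI[of _ "Suc r"] exI[of _ s]) simp
  next
    case 2
    then show ?thesis using * by (intro exI[of _ 0] exI[of _ "Suc s"]) simp
  next
    case 3
    have "del_step j (x # replicate r j @ replicate s (Suc j))
        (replicate r' j @ replicate s (Suc j))"
      using del_step.intros[of j "[]"] 3 by simp
    then show ?thesis using * by (meson rtranclp.rtrancl_into_rtrancl)
  qed
qed

lemma max_prefix_sum_append_cong:
  "max_prefix_sum v = max_prefix_sum v' \<Longrightarrow> max_prefix_sum (u @ v) = max_prefix_sum (u @ v')"
  by (induction u) auto

text \<open>A deleted pair has weights -1, 1: its total is 0, and the prefix ending inside it lies
  below the prefix ending before it. Together the two invariants determine both exponents of a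
  normal form.\<close>

lemma del_steps_invariant:
  assumes "(del_step j)\<^sup>*\<^sup>* u v"
  shows "max_prefix_sum (map (weight j) u) = max_prefix_sum (map (weight j) v) \<and>
    sum_list (map (weight j) u) = sum_list (map (weight j) v)"
  using assms
proof (induction rule: rtranclp_induct)
  case (step v v')
  from step.hyps(2) obtain a b where v: "v = a @ [Suc j, j] @ b" "v' = a @ b"
    by (auto elim: del_step.cases)
  have "max_prefix_sum (map (weight j) ([Suc j, j] @ b)) = max_prefix_sum (map (weight j) b)"
    using max_prefix_sum_nonneg[of "map (weight j) b"] by (simp add: weight_def)
  then have "max_prefix_sum (map (weight j) v) = max_prefix_sum (map (weight j) v')"
    unfolding v map_append by (rule max_prefix_sum_append_cong)
  moreover have "sum_list (map (weight j) v) = sum_list (map (weight j) v')"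
    by (simp add: v weight_def)
  ultimately show ?case using step.IH by simp
qed simp

lemma max_prefix_sum_normal_form:
  "max_prefix_sum (map (weight j) (replicate r j @ replicate s (Suc j))) = int r"
proof (induction r)
  case 0
  show ?case by (induction s) (auto simp: weight_def)
qed (auto simp: weight_def)

lemma sum_list_normal_form:
  "sum_list (map (weight j) (replicate r j @ replicate s (Suc j))) = int r - int s"
  by (simp add: weight_def sum_list_replicate)

text \<open>A normal form has maximal prefix sum \<open>r\<close> and total \<open>r - s\<close>.
  Equal counts make the total 0, so \<open>s = r\<close> is the maximum. This also gives the
  uniqueness that the definite description in \<open>depth\<close> requires.\<close>

lemma depth_eq_max_prefix_sum:
  assumes "count_list w j = count_list w (Suc j)"
  shows "int (depth j w) = max_prefix_sum (map (weight j) w)"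
proof -
  let ?f = "filter (\<lambda>x. x = j \<or> x = Suc j) w"
  have weight_outside: "(\<lambda>x. if x = j \<or> x = Suc j then weight j x else 0) = weight j"
    by (auto simp: weight_def)
  have max: "max_prefix_sum (map (weight j) ?f) = max_prefix_sum (map (weight j) w)"
    by (simp only: max_prefix_sum_filter weight_outside)
  have sum: "sum_list (map (weight j) ?f) = 0"
    using assms by (subst sum_list_map_filter) (auto simp: sum_list_map_weight, simp add: weight_def)
  have unique: "int s = max_prefix_sum (map (weight j) w)"
    if "(del_step j)\<^sup>*\<^sup>* ?f (replicate r j @ replicate s (Suc j))" for r s
    using del_steps_invariant[OF that] max sum
    unfolding max_prefix_sum_normal_form sum_list_normal_form by simp
  obtain r s where rs: "(del_step j)\<^sup>*\<^sup>* ?f (replicate r j @ replicate s (Suc j))"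
    using del_steps_normal_form[of ?f j] by auto
  have "depth j w = s"
    unfolding depth_def
  proof (rule the_equality)
    show "\<exists>r. (del_step j)\<^sup>*\<^sup>* ?f (replicate r j @ replicate s (Suc j))" using rs by blast
  next
    fix s'
    assume "\<exists>r. (del_step j)\<^sup>*\<^sup>* ?f (replicate r j @ replicate s' (Suc j))"
    then show "s' = s" using unique rs by (metis of_nat_eq_iff)
  qed
  then show ?thesis using unique rs by simp
qed

section \<open>Charge of a permutation\<close>

text \<open>Here \<open>r\<close> is the inverse of \<open>u\<close> with positions counted from 0.
  The reversed inverse reads \<open>r k, ..., r 1\<close>, so a descent at position \<open>i\<close>
  compares \<open>r (Suc j)\<close> with \<open>r j\<close> for \<open>j = k - i\<close> and
  contributes \<open>i = k - j\<close>.\<close>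

lemma perm_charge_eq_sum:
  assumes len: "length u = k"
    and pos: "\<And>i. 1 \<le> i \<Longrightarrow> i \<le> k \<Longrightarrow> r i < k \<and> u ! r i = i"
    and uniq: "\<And>i q. 1 \<le> i \<Longrightarrow> i \<le> k \<Longrightarrow> q < k \<Longrightarrow> u ! q = i \<Longrightarrow> q = r i"
  shows "perm_charge u = (\<Sum>j = 1..k - 1. if r j < r (Suc j) then k - j else 0)"
proof -
  have the_r: "(THE q. q < length u \<and> u ! q = i) = r i" if "1 \<le> i" "i \<le> k" for i
    using that pos uniq len by (intro the_equality) auto
  have "perm_inverse u = map (\<lambda>i. Suc (r i)) [1..<Suc k]"
    unfolding perm_inverse_def using the_r len by (intro map_cong) (auto simp del: upt_Suc)
  then have nth: "rev (perm_inverse u) ! i = Suc (r (k - i))" if "i < k" for i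
    using that by (simp add: rev_nth Suc_diff_Suc del: upt_Suc)
  have len': "length (perm_inverse u) = k" by (simp add: perm_inverse_def len)
  have "{i. 1 \<le> i \<and> i < k \<and> rev (perm_inverse u) ! (i - 1) > rev (perm_inverse u) ! i}
      = {i \<in> {1..<k}. r (k - i) < r (Suc (k - i))}"
    by (auto simp: nth Suc_diff_le Suc_diff_Suc)
  then have "perm_charge u = (\<Sum>i\<in>{1..<k}. if r (k - i) < r (Suc (k - i)) then i else 0)"
    by (simp add: perm_charge_def maj_def len' sum.inter_filter[symmetric])
  also have "\<dots> = (\<Sum>j = 1..k - 1. if r j < r (Suc j) then k - j else 0)"
    by (rule sum.reindex_bij_witness[of _ "\<lambda>j. k - j" "\<lambda>i. k - i"]) auto
  finally show ?thesis .
qed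

section \<open>Removing a standard subword\<close>

lemma nths_eq_map_filter: "nths w S = map ((!) w) (filter (\<lambda>i. i \<in> S) [0..<length w])"
proof -
  have "zip w [0..<length w] = map (\<lambda>i. (w ! i, i)) [0..<length w]"
    by (rule nth_equalityI) auto
  then show ?thesis by (simp add: nths_def filter_map o_def)
qed

lemma count_list_nths: "count_list (nths w S) a = card (occurrences a w \<inter> S)"
proof -
  have "count_list (nths w S) a
      = length (filter (\<lambda>i. i \<in> S \<and> w ! i = a) [0..<length w])"
    by (simp add: count_list_eq_length_filter nths_eq_map_filter filter_map o_def eq_commute[of a]
        conj_commute)
  also have "\<dots> = card (set (filter (\<lambda>i. i \<in> S \<and> w ! i = a) [0..<length w]))"
    by (rule distinct_card[symmetric]) simp
  also have "set (filter (\<lambda>i. i \<in> S \<and> w ! i = a) [0..<length w]) = occurrences a w \<inter> S"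
    by (auto simp: occurrences_def)
  finally show ?thesis .
qed

lemma count_list_eq_card_occurrences: "count_list w a = card (occurrences a w)"
  using count_list_nths[of w UNIV a] by (simp add: nths_all)

lemma finite_occurrences: "finite (occurrences a w)"
  by (simp add: occurrences_def)

text \<open>The multiplicity is a successor so that every letter is available for one selection; the
  word left over has multiplicity \<open>n\<close>.\<close>

locale rectangular_word =
  fixes w :: "nat list" and k n :: nat
  assumes letters: "set w \<subseteq> {1..k}"
    and count: "a \<in> {1..k} \<Longrightarrow> count_list w a = Suc n"
    and k_pos: "1 \<le> k"
begin

lemma occurrences_nonempty: "a \<in> {1..k} \<Longrightarrow> occurrences a w \<noteq> {}"
  using count[of a] by (auto simp: count_list_eq_card_occurrences)

lemma chain_pos_Some:
  "i < k \<Longrightarrow> \<exists>p. chain_pos w i = Some p \<and> p \<in> occurrences (Suc i) w"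
proof (induction i)
  case 0
  then show ?case
    using occurrences_nonempty[of 1] Max_in[OF finite_occurrences, of 1 w] by simp
next
  case (Suc i)
  then obtain p where p: "chain_pos w i = Some p" by auto
  let ?Q = "occurrences (i + 2) w"
  let ?L = "{q \<in> ?Q. q < p}"
  have Q: "?Q \<noteq> {}" using Suc.prems occurrences_nonempty[of "i + 2"] by simp
  have "Max ?L \<in> ?Q" if "?L \<noteq> {}"
    using Max_in[of ?L] that finite_occurrences by simp
  moreover have "Max ?Q \<in> ?Q" using Q finite_occurrences by (rule Max_in[rotated])
  ultimately show ?case using p Q by (auto simp: Let_def)
qed

text \<open>Reindexes the selection by letter: \<open>chain_pos\<close> counts from 0, letters from
  1. The value is meaningful for letters in \<open>{1..k}\<close>, where the selection cannot
  stop.\<close>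

definition pos :: "nat \<Rightarrow> nat" where
  "pos a = the (chain_pos w (a - 1))"

lemma chain_pos_eq: "i < k \<Longrightarrow> chain_pos w i = Some (pos (Suc i))"
  using chain_pos_Some[of i] by (auto simp: pos_def)

lemma pos_occurrence: "a \<in> {1..k} \<Longrightarrow> pos a < length w \<and> w ! pos a = a"
  using chain_pos_Some[of "a - 1"] by (cases a) (auto simp: pos_def occurrences_def)

lemma chain_pos_None: "k \<le> i \<Longrightarrow> chain_pos w i = None"
proof (induction i rule: dec_induct)
  case base
  have "occurrences (Suc k) w = {}"
    using letters by (auto simp: occurrences_def dest!: nth_mem)
  then show ?case
    \<comment> \<open>As \<open>k\<close> is a successor, the selection at index \<open>k\<close>
      looks for the letter \<open>k + 1\<close>, which is absent.\<close>
    using k_pos chain_pos_eq[of "k - 1"] by (cases k) auto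
qed simp

lemma chain_set_eq: "chain_set w = pos ` {1..k}"
proof
  show "chain_set w \<subseteq> pos ` {1..k}"
  proof
    fix q assume "q \<in> chain_set w"
    then obtain i where i: "chain_pos w i = Some q" by (auto simp: chain_set_def)
    then have "i < k" using chain_pos_None[of i] by force
    then show "q \<in> pos ` {1..k}" using i chain_pos_eq[of i] by auto
  qed
  show "pos ` {1..k} \<subseteq> chain_set w"
  proof
    fix q assume "q \<in> pos ` {1..k}"
    then obtain a where a: "a \<in> {1..k}" "q = pos a" by blast
    then have "chain_pos w (a - 1) = Some q" by (cases a) (auto intro: chain_pos_eq)
    then show "q \<in> chain_set w" by (auto simp: chain_set_def)
  qed
qed

lemma chain_set_letter: "q \<in> chain_set w \<Longrightarrow> w ! q = a \<Longrightarrow> q = pos a"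
  using pos_occurrence by (auto simp: chain_set_eq)

text \<open>Both branches of the selection take a maximum, which rules out further letters
  \<open>Suc j\<close> on a stretch of the word. The four facts are what the two removal lemmas
  require, the second for a step without wrap-around and the last two for a wrapped one.\<close>

lemma pos_step:
  assumes "1 \<le> j" "j < k"
  shows "pos j \<noteq> pos (Suc j)"
    and "pos (Suc j) < pos j \<Longrightarrow> pos (Suc j) < i \<Longrightarrow> i < pos j \<Longrightarrow> w ! i \<noteq> Suc j"
    and "pos j < pos (Suc j) \<Longrightarrow> i < pos j \<Longrightarrow> w ! i \<noteq> Suc j"
    and "pos j < pos (Suc j) \<Longrightarrow> pos (Suc j) < i \<Longrightarrow> i < length w \<Longrightarrow> w ! i \<noteq> Suc j"
proof -
  let ?Q = "occurrences (Suc j) w"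
  let ?L = "{q \<in> ?Q. q < pos j}"
  have jk: "j \<in> {1..k}" "Suc j \<in> {1..k}" using assms by auto
  note occ = pos_occurrence[OF jk(1)] pos_occurrence[OF jk(2)]
  then show "pos j \<noteq> pos (Suc j)" by (metis n_not_Suc_n)
  have Q: "?Q \<noteq> {}" using jk by (intro occurrences_nonempty)
  have "chain_pos w (Suc (j - 1)) = (if ?L \<noteq> {} then Some (Max ?L) else Some (Max ?Q))"
    using assms chain_pos_eq[of "j - 1"] Q by (cases j) (auto simp: Let_def)
  then have step: "pos (Suc j) = (if ?L \<noteq> {} then Max ?L else Max ?Q)"
    using assms chain_pos_eq[of j] by (auto split: if_splits)
  have fin: "finite ?L" using finite_occurrences by simp
  \<comment> \<open>Contrapositively, \<open>pos j < pos (Suc j)\<close> means that the selection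
    wrapped around.\<close>
  have L: "pos (Suc j) < pos j" if "?L \<noteq> {}"
    using Max_in[OF fin that] step that by simp
  show "w ! i \<noteq> Suc j" if "pos (Suc j) < pos j" "pos (Suc j) < i" "i < pos j"
  proof
    assume "w ! i = Suc j"
    then have "i \<in> ?L" using that occ by (auto simp: occurrences_def)
    then have "i \<le> Max ?L" "?L \<noteq> {}" using fin by (auto simp del: Collect_empty_eq)
    then show False using step that by auto
  qed
  show "w ! i \<noteq> Suc j" if "pos j < pos (Suc j)" "i < pos j"
  proof
    assume "w ! i = Suc j"
    then have "i \<in> ?L" using that occ by (auto simp: occurrences_def)
    then show False using L that by fastforce
  qed
  show "w ! i \<noteq> Suc j" if "pos j < pos (Suc j)" "pos (Suc j) < i" "i < length w"
  proof
    assume "w ! i = Suc j"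
    then have "i \<in> ?Q" using that by (auto simp: occurrences_def)
    then have "i \<le> Max ?Q" using finite_occurrences by simp
    moreover have "?L = {}" using L that by fastforce
    ultimately show False using step that by auto
  qed
qed

lemma count_list_rest:
  assumes "a \<in> {1..k}"
  shows "count_list (nths w (- chain_set w)) a = n"
proof -
  have "pos a \<in> chain_set w" using assms by (simp add: chain_set_eq)
  then have "occurrences a w \<inter> - chain_set w = occurrences a w - {pos a}"
    using chain_set_letter by (auto simp: occurrences_def)
  moreover have "pos a \<in> occurrences a w"
    using pos_occurrence[OF assms] by (simp add: occurrences_def)
  ultimately show ?thesis
    using count[OF assms]
    by (simp add: count_list_nths count_list_eq_card_occurrences[of w] card_Diff_singleton)
qed

lemma depth_rest:
  assumes "1 \<le> j" "j < k"
  shows "depth j w = depth j (nths w (- chain_set w)) + (if pos j < pos (Suc j) then 1 else 0)"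
proof -
  let ?xs = "map (weight j) w"
  let ?w' = "nths w (- chain_set w)"
  have jk: "j \<in> {1..k}" "Suc j \<in> {1..k}" using assms by auto
  note occ = pos_occurrence[OF jk(1)] pos_occurrence[OF jk(2)]
  \<comment> \<open>The chain holds each letter once, so among its positions only
    \<open>pos j\<close> and \<open>pos (Suc j)\<close> have nonzero weight.\<close>
  have "map (\<lambda>i. if i \<notin> chain_set w then weight j (w ! i) else 0) [0..<length w]
      = ?xs[pos j := 0, pos (Suc j) := 0]"
  proof (rule nth_equalityI)
    fix i
    assume "i < length (map (\<lambda>i. if i \<notin> chain_set w then weight j (w ! i) else 0) [0..<length w])"
    moreover have "weight j (w ! i) = 0"
      if "i \<in> chain_set w" "i \<noteq> pos j" "i \<noteq> pos (Suc j)"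
      using that chain_set_letter by (auto simp: weight_def)
    moreover have "pos j \<in> chain_set w" "pos (Suc j) \<in> chain_set w"
      using jk by (auto simp: chain_set_eq)
    ultimately show "map (\<lambda>i. if i \<notin> chain_set w then weight j (w ! i) else 0) [0..<length w] ! i
        = ?xs[pos j := 0, pos (Suc j) := 0] ! i"
      using occ by (auto simp: nth_list_update)
  qed simp
  then have rest: "max_prefix_sum (map (weight j) ?w')
      = max_prefix_sum (?xs[pos j := 0, pos (Suc j) := 0])"
    by (simp add: nths_eq_map_filter max_prefix_sum_filter o_def)
  have sum: "sum_list ?xs = 0"
    using count[OF jk(1)] count[OF jk(2)] by (simp add: sum_list_map_weight)
  have wt: "?xs ! pos j = 1" "?xs ! pos (Suc j) = -1" using occ by (auto simp: weight_def)
  have wt_nonneg: "0 \<le> ?xs ! i" if "i < length w" "w ! i \<noteq> Suc j" for i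
    using that by (auto simp: weight_def)
  have "max_prefix_sum ?xs
      = max_prefix_sum (?xs[pos j := 0, pos (Suc j) := 0]) + (if pos j < pos (Suc j) then 1 else 0)"
  proof (cases "pos j < pos (Suc j)")
    case True
    have "max_prefix_sum (?xs[pos j := 0, pos (Suc j) := 0]) = max_prefix_sum ?xs - 1"
      using True wt occ sum pos_step[OF assms]
      by (intro max_prefix_sum_remove_wrapped wt_nonneg) auto
    then show ?thesis using True by simp
  next
    case False
    then have less: "pos (Suc j) < pos j" using pos_step(1)[OF assms] by simp
    have "max_prefix_sum (?xs[pos j := 0, pos (Suc j) := 0]) = max_prefix_sum ?xs"
      using less wt occ pos_step(2)[OF assms]
      by (intro max_prefix_sum_remove_matched wt_nonneg) auto
    then show ?thesis using False by simp
  qed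
  moreover have "int (depth j w) = max_prefix_sum ?xs"
    using count jk by (intro depth_eq_max_prefix_sum) simp
  moreover have "int (depth j ?w') = max_prefix_sum (map (weight j) ?w')"
    using count_list_rest jk by (intro depth_eq_max_prefix_sum) simp
  ultimately show ?thesis using rest by (simp split: if_splits)
qed

text \<open>Passing to the subword keeps the order of the selected positions, so comparing places in
  the subword amounts to comparing \<open>pos\<close> in \<open>w\<close>.\<close>

lemma perm_charge_chain:
  "perm_charge (nths w (chain_set w))
    = (\<Sum>j = 1..k - 1. if pos j < pos (Suc j) then k - j else 0)"
proof -
  define l where "l = filter (\<lambda>i. i \<in> chain_set w) [0..<length w]"
  have u: "nths w (chain_set w) = map ((!) w) l" by (simp add: nths_eq_map_filter l_def)
  have set_l: "set l = pos ` {1..k}"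
    using pos_occurrence by (auto simp: l_def chain_set_eq)
  have inj: "inj_on pos {1..k}" by (rule inj_onI) (metis pos_occurrence)
  have sorted: "sorted_wrt (<) l" by (simp add: l_def sorted_wrt_filter)
  then have dist: "distinct l" by (simp add: l_def)
  then have len: "length l = k" using distinct_card[of l] set_l inj by (simp add: card_image)
  have "\<forall>i\<in>{1..k}. \<exists>q<k. l ! q = pos i"
    using set_l len by (metis imageI in_set_conv_nth)
  \<comment> \<open>\<open>r i\<close> is the place of the letter \<open>i\<close> within the
    subword, since \<open>l\<close> lists the chain from left to right.\<close>
  then obtain r where r: "\<And>i. i \<in> {1..k} \<Longrightarrow> r i < k \<and> l ! r i = pos i" by metis
  have less: "r i < r j \<longleftrightarrow> pos i < pos j" if "i \<in> {1..k}" "j \<in> {1..k}" for i j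
    using r[OF that(1)] r[OF that(2)] sorted_wrt_nth_less[OF sorted] len
    by (metis linorder_neqE_nat order_less_asym less_irrefl)
  have "perm_charge (nths w (chain_set w))
      = (\<Sum>j = 1..k - 1. if r j < r (Suc j) then k - j else 0)"
  proof (rule perm_charge_eq_sum)
    show "length (nths w (chain_set w)) = k" by (simp add: u len)
    show "r i < k \<and> nths w (chain_set w) ! r i = i" if "1 \<le> i" "i \<le> k" for i
      using that r[of i] pos_occurrence[of i] by (simp add: u len)
    show "q = r i" if "1 \<le> i" "i \<le> k" "q < k" "nths w (chain_set w) ! q = i" for i q
    proof -
      have "l ! q \<in> chain_set w" using that len nth_mem[of q l] by (simp add: set_l chain_set_eq)
      moreover have "w ! (l ! q) = i" using that len by (simp add: u)
      ultimately have "l ! q = l ! r i" using chain_set_letter r[of i] that by simp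
      moreover have "r i < k" using r[of i] that by simp
      ultimately show ?thesis using nth_eq_iff_index_eq[OF dist] that len by blast
    qed
  qed
  also have "\<dots> = (\<Sum>j = 1..k - 1. if pos j < pos (Suc j) then k - j else 0)"
    by (rule sum.cong) (auto simp: less)
  finally show ?thesis .
qed

end

section \<open>Induction on the common multiplicity of the letters\<close>

lemma sum_perm_charge_extract_subwords:
  assumes "set w \<subseteq> {1..k}" "\<forall>a\<in>{1..k}. count_list w a = n" "1 \<le> k"
  shows "(\<Sum>u\<leftarrow>extract_subwords n w. perm_charge u) = (\<Sum>j = 1..k - 1. depth j w * (k - j))"
  using assms
proof (induction n arbitrary: w)
  case 0
  have "depth j w = 0" if "j \<in> {1..k - 1}" for j
  proof -
    have "w = []"
      using 0 by (metis count_list_0_iff list.set_intros(1) neq_Nil_conv subsetD)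
    then show ?thesis using depth_eq_max_prefix_sum[of w j] by simp
  qed
  then show ?case by simp
next
  case (Suc n)
  then interpret rectangular_word w k n by unfold_locales auto
  let ?w' = "nths w (- chain_set w)"
  have "set ?w' \<subseteq> {1..k}" using letters set_nths_subset by fast
  then have IH: "(\<Sum>u\<leftarrow>extract_subwords n ?w'. perm_charge u)
      = (\<Sum>j = 1..k - 1. depth j ?w' * (k - j))"
    using Suc.IH[of ?w'] count_list_rest k_pos by simp
  \<comment> \<open>Each wrap lowers one depth by 1, hence the weighted sum by \<open>k - j\<close>;
    these losses add up to the charge of the extracted subword.\<close>
  have "(\<Sum>j = 1..k - 1. depth j w * (k - j))
      = (\<Sum>j = 1..k - 1. depth j ?w' * (k - j) + (if pos j < pos (Suc j) then k - j else 0))"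
    by (rule sum.cong) (auto simp: depth_rest)
  then show ?case by (simp add: IH perm_charge_chain sum.distrib)
qed

theorem mainTheorem4:
  fixes w :: "nat list" and k n :: nat
  assumes "set w \<subseteq> {1..k}"
    and "\<forall>a\<in>{1..k}. count_list w a = n"
  shows "charge w = (\<Sum>j = 1..k - 1. depth j w * (k - j))"
proof (cases "1 \<le> k")
  case True
  \<comment> \<open>As \<open>1\<close> is a letter, the number \<open>count_list w 1\<close> of
    extractions is \<open>n\<close>.\<close>
  then show ?thesis
    using assms sum_perm_charge_extract_subwords[of w k n]
    by (simp add: charge_def standard_subwords_def)
next
  case False
  \<comment> \<open>For \<open>k = 0\<close> the word is empty and the sum has an empty
    range.\<close>
  then show ?thesis using assms by (simp add: charge_def standard_subwords_def)
qed

end
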